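(* Let $S \subset \mathbb{R}^2$ be a starlike disk, that is, a topological disk that is starlike relative to some point $p$. Then its Hadwiger number satisfies $H(S) \leq 35$.
   Context: A (topological) disk is a compact subset of $\mathbb{R}^2$ with a simple, closed, continuous curve as its boundary, i.e. a subset of $\mathbb{R}^2$ homeomorphic to the closed unit disk. A disk $S$ is starlike relative to a point $p$ if, for every $q \in S$, $S$ contains the closed segment $[p,q]$. Two disks are nonoverlapping if their interiors are disjoint; two disks $J_1, J_2$ touch if they are nonoverlapping and $J_1 \cap J_2 \neq \emptyset$. The Hadwiger number $H(J)$ of a disk $J$ is the maximal number of pairwise nonoverlapping translates of $J$ each of which touches $J$. *)

theory Defs
  imports "HOL-Analysis.Analysis" "HOL-Library.Extended_Nat"
begin

definition topological_disk :: "(real^2) set \<Rightarrow> bool"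
  where "topological_disk S \<longleftrightarrow> S homeomorphic (cball 0 1 :: (real^2) set)"

definition nonoverlapping :: "(real^2) set \<Rightarrow> (real^2) set \<Rightarrow> bool"
  where "nonoverlapping A B \<longleftrightarrow> interior A \<inter> interior B = {}"

definition touch :: "(real^2) set \<Rightarrow> (real^2) set \<Rightarrow> bool"
  where "touch A B \<longleftrightarrow> nonoverlapping A B \<and> A \<inter> B \<noteq> {}"

definition translates :: "(real^2) set \<Rightarrow> (real^2) set set"
  where "translates J = range (\<lambda>v. (+) v ` J)"

definition hadwiger_family :: "(real^2) set \<Rightarrow> (real^2) set set \<Rightarrow> bool"
  where "hadwiger_family J F \<longleftrightarrow>
    F \<subseteq> translates J \<and> pairwise nonoverlapping F \<and> (\<forall>K\<in>F. touch J K)"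

(* An extended natural number: the supremum is infinite if families of arbitrarily large size
   exist.  Finite families suffice, since every subfamily of an admissible family is admissible. *)
definition hadwiger_number :: "(real^2) set \<Rightarrow> enat"
  where "hadwiger_number J = (SUP F \<in> {F. finite F \<and> hadwiger_family J F}. enat (card F))"

end

theory Submission imports Defs begin

text \<open>
  Put the star centre at the origin and choose \<open>e\<^sub>1, e\<^sub>2 \<in> S\<close> spanning a parallelogram of maximal area.
  In the basis \<open>e\<^sub>1, e\<^sub>2\<close> the disk \<open>S\<close> lies in \<open>[-1,1]\<^sup>2\<close>, so a translate touching \<open>S\<close> has its centre
  \<open>x = p - r\<close> (\<open>p, r \<in> S\<close>) in \<open>[-2,2]\<^sup>2\<close>.  Segments from the centres of two nonoverlapping translates
  cannot cross.  Applied to copies of \<open>[0,e\<^sub>1]\<close> and \<open>[0,e\<^sub>2]\<close> this shows that two centres whose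
  coordinates differ by less than 1 are strictly comparable in the product order, so the centres in
  a unit cell form a chain.  Crossings of the copies of \<open>[0,p]\<close> and \<open>[0,r]\<close>, for the greatest centre of a
  chain, with those of \<open>[0,e\<^sub>1]\<close> and \<open>[0,e\<^sub>2]\<close> bound its length: at most one centre for six of the
  sixteen cells, at most two for the other ten.  With at most eight centres on the coordinate axes
  this gives \<open>6 \<cdot> 1 + 10 \<cdot> 2 + 8 = 34\<close>.
\<close>

subsection \<open>Chains of translation vectors in the unit cells\<close>

lemma card_Un_le_add: "\<lbrakk>card A \<le> m; card B \<le> n\<rbrakk> \<Longrightarrow> card (A \<union> B) \<le> m + n"
  using card_Un_le[of A B] by linarith

text \<open>
  The points of \<open>X\<close> are translation vectors in the basis \<open>e\<^sub>1, e\<^sub>2\<close>.  The assumption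
  \<open>separated\<close> says that the segment from \<open>y\<close> to \<open>y + a\<close> does not cross the one from \<open>x\<close> to \<open>x + b\<close>.
\<close>

locale star_packing =
  fixes S X :: "(real \<times> real) set"
  assumes box: "(u, v) \<in> S \<Longrightarrow> \<bar>u\<bar> \<le> 1 \<and> \<bar>v\<bar> \<le> 1"
    and e1: "(1, 0) \<in> S" and e2: "(0, 1) \<in> S"
    and zero: "0 \<notin> X"
    and touching: "x \<in> X \<Longrightarrow> \<exists>p\<in>S. \<exists>r\<in>S. x = p - r"
    and separated: "\<lbrakk>x \<in> insert 0 X; y \<in> insert 0 X; a \<in> S; b \<in> S; fst a * snd b \<noteq> snd a * fst b;
      0 \<le> s; s < 1; 0 \<le> t; t < 1; x - y = s *\<^sub>R a - t *\<^sub>R b\<rbrakk> \<Longrightarrow> x = y"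
begin

text \<open>Only differences of centres enter the conditions: \<open>separated\<close> for
  \<open>- x\<close> and \<open>- y\<close> is \<open>separated\<close> for the exchanged pair, so
  \<open>S\<close> stays as it is.\<close>

lemma star_packing_uminus: "star_packing S (uminus ` X)"
proof
  fix x assume "x \<in> uminus ` X"
  then obtain p r where "p \<in> S" "r \<in> S" "x = - (p - r)" using touching by blast
  then show "\<exists>p\<in>S. \<exists>r\<in>S. x = p - r" by force
next
  fix x y a b and s t :: real
  assume "x \<in> insert 0 (uminus ` X)" "y \<in> insert 0 (uminus ` X)"
  then have "- x \<in> insert 0 X" "- y \<in> insert 0 X" by auto
  moreover assume "a \<in> S" "b \<in> S" "fst a * snd b \<noteq> snd a * fst b"
    "0 \<le> s" "s < 1" "0 \<le> t" "t < 1" "x - y = s *\<^sub>R a - t *\<^sub>R b"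
  ultimately have "- y = - x" by (intro separated[of "- y" "- x" a b s t]) auto
  then show "x = y" by simp
qed (use box e1 e2 zero in \<open>auto simp: zero_prod_def\<close>)

lemma star_packing_swap: "star_packing (prod.swap ` S) (prod.swap ` X)"
proof
  fix x assume "x \<in> prod.swap ` X"
  then obtain p r where "p \<in> S" "r \<in> S" "x = prod.swap (p - r)" using touching by blast
  then show "\<exists>p\<in>prod.swap ` S. \<exists>r\<in>prod.swap ` S. x = p - r"
    by (intro bexI[of _ "prod.swap p"] bexI[of _ "prod.swap r"]) (auto simp: prod_eq_iff)
next
  fix x y a b and s t :: real
  assume "x \<in> insert 0 (prod.swap ` X)" "y \<in> insert 0 (prod.swap ` X)"
    and "a \<in> prod.swap ` S" "b \<in> prod.swap ` S" "fst a * snd b \<noteq> snd a * fst b"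
    "0 \<le> s" "s < 1" "0 \<le> t" "t < 1" "x - y = s *\<^sub>R a - t *\<^sub>R b"
  then have "prod.swap x = prod.swap y"
    by (intro separated[of "prod.swap x" "prod.swap y" "prod.swap a" "prod.swap b" s t])
      (auto simp: prod_eq_iff)
  then show "x = y" by (simp add: prod_eq_iff)
qed (use box e1 e2 zero in \<open>force simp: zero_prod_def image_iff\<close>)+

section \<open>Forbidden crossings\<close>

lemma separatedD:
  assumes "(x1, x2) \<in> insert 0 X" "(y1, y2) \<in> insert 0 X" "(a1, a2) \<in> S" "(b1, b2) \<in> S"
    "a1 * b2 \<noteq> a2 * b1" "0 \<le> s" "s < 1" "0 \<le> t" "t < 1"
    "x1 - y1 = s * a1 - t * b1" "x2 - y2 = s * a2 - t * b2"
  shows "x1 = y1 \<and> x2 = y2"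
  using separated[of "(x1, x2)" "(y1, y2)" "(a1, a2)" "(b1, b2)" s t] assms by auto

text \<open>Otherwise one centre is weakly to the upper left of the other; its copy of
  \<open>[0,e1]\<close> then meets the copy of \<open>[0,e2]\<close> at the other.\<close>

lemma close_points_ordered:
  assumes "(x1, x2) \<in> insert 0 X" "(y1, y2) \<in> insert 0 X" "\<bar>y1 - x1\<bar> < 1" "\<bar>y2 - x2\<bar> < 1"
    "(x1, x2) \<noteq> (y1, y2)"
  shows "(x1 < y1 \<and> x2 < y2) \<or> (y1 < x1 \<and> y2 < x2)"
proof (rule ccontr)
  assume "\<not> ?thesis"
  then consider "x1 \<le> y1" "y2 \<le> x2" | "y1 \<le> x1" "x2 \<le> y2" by linarith
  then show False
  proof cases
    case 1
    then show False
      using separatedD[OF assms(2,1) e1 e2, of "y1 - x1" "x2 - y2"] assms by auto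
  next
    case 2
    then show False
      using separatedD[OF assms(1,2) e1 e2, of "x1 - y1" "y2 - x2"] assms by auto
  qed
qed

text \<open>If \<open>x + s\<close> exceeded \<open>y\<close> in both coordinates, the segment from
  \<open>x\<close> to \<open>x + s\<close> would pass right of \<open>y\<close>, crossing its copy
  of \<open>[0,e1]\<close>, or above \<open>y\<close>, crossing its copy of
  \<open>[0,e2]\<close>.\<close>

lemma not_both_below:
  assumes "(x1, x2) \<in> insert 0 X" "(y1, y2) \<in> insert 0 X" "x1 < y1" "x2 < y2" "(s1, s2) \<in> S"
  shows "s1 \<le> y1 - x1 \<or> s2 \<le> y2 - x2"
proof (rule ccontr)
  assume "\<not> ?thesis"
  then have s: "y1 - x1 < s1" "y2 - x2 < s2" by auto
  have le1: "s1 \<le> 1" "s2 \<le> 1" using box[OF assms(5)] by auto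
  have pos: "s1 > 0" "s2 > 0" using s assms by auto
  show False
  proof (cases "(y1 - x1) * s2 \<le> (y2 - x2) * s1")
    case True
    define c where "c = (y2 - x2) / s2"
    have c: "0 \<le> c" "c < 1" "y2 - x2 = c * s2" using s assms pos by (auto simp: c_def field_simps)
    have "y1 - x1 \<le> c * s1" using True pos by (simp add: c_def field_simps)
    moreover have "c * s1 \<le> 1 * 1" using c le1 pos by (intro mult_mono) auto
    ultimately have "x1 = y1"
      using separatedD[OF assms(2,1,5) e1, of c "c * s1 - (y1 - x1)"] c pos assms by auto
    then show False using assms by simp
  next
    case False
    define c where "c = (y1 - x1) / s1"
    have c: "0 \<le> c" "c < 1" "y1 - x1 = c * s1" using s assms pos by (auto simp: c_def field_simps)
    have "y2 - x2 \<le> c * s2" using False pos by (simp add: c_def field_simps)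
    moreover have "c * s2 \<le> 1 * 1" using c le1 pos by (intro mult_mono) auto
    ultimately have "x1 = y1"
      using separatedD[OF assms(2,1,5) e2, of c "c * s2 - (y2 - x2)"] c pos assms by auto
    then show False using assms by simp
  qed
qed

text \<open>The copy of \<open>[0,s]\<close> at \<open>y\<close> descends below \<open>x\<close>.
  Divided by \<open>- s2\<close>, the conclusion says that it meets height \<open>x2\<close> at
  abscissa \<open>x1 + 1\<close> or further right: otherwise it would cross the copy of
  \<open>[0,e1]\<close> at \<open>x\<close> or, passing left of \<open>x\<close>, that of
  \<open>[0,e2]\<close>.\<close>

lemma no_overlap_below:
  assumes "(x1, x2) \<in> insert 0 X" "(y1, y2) \<in> insert 0 X" "x1 < y1" "x2 < y2"
    "y1 - x1 < 1" "y2 - x2 < 1" "(s1, s2) \<in> S" "y2 - x2 < - s2"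
  shows "- s2 \<le> (y1 - x1) * - s2 + (y2 - x2) * s1"
proof (rule ccontr)
  define m u v where "m = - s2" and "u = y1 - x1" and "v = y2 - x2"
  have m: "0 < m" "v < m" and uv: "0 < u" "0 < v" "u < 1" "v < 1"
    using assms by (auto simp: m_def u_def v_def)
  assume "\<not> ?thesis"
  then have lt: "u * m + v * s1 < m" by (simp add: m_def u_def v_def)
  show False
  proof (cases "u * m + v * s1 \<ge> 0")
    case True
    \<comment> \<open>The parameter of height \<open>x2\<close>; there the abscissa exceeds
      \<open>x1\<close> by \<open>u + c * s1\<close>.\<close>
    define c where "c = v / m"
    have c: "0 \<le> c" "c < 1" "v = c * m" using m uv by (auto simp: c_def)
    have "u * m + v * s1 = (u + c * s1) * m" by (simp add: c algebra_simps)
    then have "0 \<le> (u + c * s1) * m" "(u + c * s1) * m < 1 * m" using True lt by simp_all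
    then have t: "0 \<le> u + c * s1" "u + c * s1 < 1"
      using m by (simp_all add: zero_le_mult_iff)
    have "y1 - x1 = (u + c * s1) * 1 - c * s1" "y2 - x2 = (u + c * s1) * 0 - c * s2"
      using c by (simp_all add: u_def v_def m_def)
    with t c m have "x1 = y1"
      using separatedD[OF assms(2,1) e1 assms(7), of "u + c * s1" c] by (simp add: m_def)
    then show False using assms by simp
  next
    case False
    define a where "a = - s1"
    \<comment> \<open>The parameter of abscissa \<open>x1\<close>; there the height exceeds
      \<open>x2\<close> by \<open>v - c * m\<close>.\<close>
    define c where "c = u / a"
    have ua: "u * m < v * a" using False by (simp add: a_def)
    have "0 < u * m" using uv m by simp
    with ua have "0 < v * a" by linarith
    then have a: "a > 0" using uv by (simp add: zero_less_mult_iff)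
    have "v * a < m * a" using m a by simp
    with ua have "u * m < a * m" by (simp add: mult.commute)
    then have "u < a" using m by simp
    then have c: "0 \<le> c" "c < 1" "u = c * a" using uv a by (auto simp: c_def)
    have "c * m * a < v * a" using ua c by (simp add: mult_ac)
    then have cm: "c * m < v" using a by simp
    have "0 \<le> c * m" using c m by simp
    then have t: "0 \<le> v - c * m" "v - c * m < 1" using cm uv by auto
    have "y1 - x1 = (v - c * m) * 0 - c * s1" "y2 - x2 = (v - c * m) * 1 - c * s2"
      using c by (simp_all add: u_def v_def m_def a_def)
    with t c a have "x1 = y1"
      using separatedD[OF assms(2,1) e2 assms(7), of "v - c * m" c] by (simp add: a_def)
    then show False using assms by simp
  qed
qed

lemma touchingE:
  assumes "(x1, x2) \<in> X"
  obtains p1 p2 r1 r2 where "(p1, p2) \<in> S" "(r1, r2) \<in> S" "x1 = p1 - r1" "x2 = p2 - r2"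
    "\<bar>p1\<bar> \<le> 1" "\<bar>p2\<bar> \<le> 1" "\<bar>r1\<bar> \<le> 1" "\<bar>r2\<bar> \<le> 1"
proof -
  obtain p r where "p \<in> S" "r \<in> S" "(x1, x2) = p - r" using touching assms by blast
  then show thesis using that[of "fst p" "snd p" "fst r" "snd r"] box[of "fst p" "snd p"] box[of "fst r" "snd r"]
    by (auto simp: prod_eq_iff)
qed

text \<open>For \<open>y = p - r\<close> the copy of \<open>[0,r]\<close> at \<open>y\<close> ends
  at \<open>p\<close>, below \<open>x\<close> since \<open>p2 \<le> 1 < x2\<close>. Both its ends
  are left of \<open>x1 + 1\<close>, against \<open>no_overlap_below\<close>.\<close>

lemma no_two_in_upper_right:
  assumes "(x1, x2) \<in> X" "(y1, y2) \<in> X" "x1 < y1" "x2 < y2" "y1 - x1 < 1" "y2 - x2 < 1"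
    "0 < x1" "1 < x2"
  shows False
proof -
  from assms(2) obtain p1 p2 r1 r2 where r: "(r1, r2) \<in> S" "y1 = p1 - r1" "y2 = p2 - r2"
    "\<bar>p1\<bar> \<le> 1" "\<bar>p2\<bar> \<le> 1" by (rule touchingE)
  define m u v where "m = - r2" and "u = y1 - x1" and "v = y2 - x2"
  have m: "0 < m" "v < m" and uv: "0 < u" "0 < v" "u < 1"
    using assms r by (auto simp: m_def u_def v_def)
  have u: "u + r1 < 1" using r assms by (simp add: u_def)
  have "m \<le> u * m + v * r1"
    using no_overlap_below[OF _ _ assms(3-6) r(1)] assms m by (auto simp: m_def u_def v_def)
  also have "v * r1 < m * (1 - u)"
  proof (cases "r1 \<le> 0")
    case True
    then have "v * r1 \<le> 0" using uv by (simp add: mult_nonneg_nonpos)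
    then show ?thesis using m uv by (smt (verit) mult_pos_pos)
  next
    case False
    then have "v * r1 < m * (1 - u)" using m uv u by (intro mult_strict_mono) auto
    then show ?thesis .
  qed
  finally show False by (simp add: algebra_simps)
qed

text \<open>With no sign condition on \<open>x1\<close>, the end \<open>p\<close> of the copy of
  \<open>[0,r]\<close> at \<open>z = p - r\<close> may lie right of \<open>x1 + 1\<close>, so two
  links of the chain are combined. Since \<open>p2 \<le> 1 < x2\<close>, \<open>r\<close> descends
  far enough to apply \<open>no_overlap_below\<close> at both links, and the sum of the two bounds
  telescopes.\<close>

lemma no_three_in_upper_chain:
  assumes "(x1, x2) \<in> X" "(y1, y2) \<in> X" "(z1, z2) \<in> X"
    "x1 < y1" "x2 < y2" "y1 < z1" "y2 < z2" "z1 - x1 < 1" "z2 - x2 < 1" "1 < x2"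
  shows False
proof -
  from assms(3) obtain p1 p2 r1 r2 where r: "(r1, r2) \<in> S" "z1 = p1 - r1" "z2 = p2 - r2"
    "\<bar>p1\<bar> \<le> 1" "\<bar>p2\<bar> \<le> 1" "\<bar>r1\<bar> \<le> 1" by (rule touchingE)
  define m where "m = - r2"
  have m: "0 < m" "z2 - x2 < m" using assms r by (auto simp: m_def)
  have "m \<le> (y1 - x1) * m + (y2 - x2) * r1"
    using no_overlap_below[of x1 x2 y1 y2 r1 r2] assms m r by (auto simp: m_def)
  moreover have "m \<le> (z1 - y1) * m + (z2 - y2) * r1"
    using no_overlap_below[of y1 y2 z1 z2 r1 r2] assms m r by (auto simp: m_def)
  ultimately have "2 * m \<le> (z1 - x1) * m + (z2 - x2) * r1" by (simp add: algebra_simps)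
  also have "\<dots> < m + m"
  proof (rule add_strict_mono)
    show "(z1 - x1) * m < m" using assms m by simp
    have "(z2 - x2) * r1 \<le> (z2 - x2) * 1" using assms r by (intro mult_left_mono) auto
    then show "(z2 - x2) * r1 < m" using m by simp
  qed
  finally show False by simp
qed

lemma no_two_in_right_upper:
  assumes "(x1, x2) \<in> X" "(y1, y2) \<in> X" "x1 < y1" "x2 < y2" "y1 - x1 < 1" "y2 - x2 < 1"
    "1 < x1" "0 < x2"
  shows False
proof -
  interpret swap: star_packing "prod.swap ` S" "prod.swap ` X" by (rule star_packing_swap)
  show False
    by (rule swap.no_two_in_upper_right[of x2 x1 y2 y1]) (use assms in force)+
qed

text \<open>Negation and exchange of coordinates turn this into a reversed chain above height
  1.\<close>

lemma no_three_in_left_chain: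
  assumes "(x1, x2) \<in> X" "(y1, y2) \<in> X" "(z1, z2) \<in> X"
    "x1 < y1" "x2 < y2" "y1 < z1" "y2 < z2" "z1 - x1 < 1" "z2 - x2 < 1" "z1 < - 1"
  shows False
proof -
  interpret uminus: star_packing S "uminus ` X" by (rule star_packing_uminus)
  interpret swap: star_packing "prod.swap ` S" "prod.swap ` uminus ` X" by (rule uminus.star_packing_swap)
  show False
    by (rule swap.no_three_in_upper_chain[of "- z2" "- z1" "- y2" "- y1" "- x2" "- x1"])
      (use assms in force)+
qed

text \<open>The origin acts as a fourth member of the chain: here its translate is \<^term>\<open>S\<close> itself.\<close>

lemma no_three_in_central_chain:
  assumes "(x1, x2) \<in> X" "(y1, y2) \<in> X" "(z1, z2) \<in> X"
    "x1 < y1" "x2 < y2" "y1 < z1" "y2 < z2" "0 < x1" "0 < x2" "z1 \<le> 1" "z2 \<le> 1"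
  shows False
proof -
  interpret swap: star_packing "prod.swap ` S" "prod.swap ` X" by (rule star_packing_swap)
  have O: "(0, 0) \<in> insert 0 X" and O': "(0, 0) \<in> insert 0 (prod.swap ` X)" by (auto simp: zero_prod_def)
  have X: "(x1, x2) \<in> insert 0 X" "(x2, x1) \<in> insert 0 (prod.swap ` X)" using assms by force+
  from assms(3) obtain p1 p2 r1 r2 where r: "(p1, p2) \<in> S" "(r1, r2) \<in> S" "z1 = p1 - r1" "z2 = p2 - r2"
    "\<bar>p1\<bar> \<le> 1" "\<bar>p2\<bar> \<le> 1" by (rule touchingE)
  have rs: "(r2, r1) \<in> prod.swap ` S" using r by force
  \<comment> \<open>The inequality says that the segment from \<open>(u, v)\<close> in direction
    \<open>(s, - m)\<close> meets height 0 left of abscissa 1.\<close>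
  have aux: "v * s < m * (1 - u)" if "0 < v" "v < m" "0 < u" "u < 1" "u + s < 1" for u v s m :: real
  proof (cases "s \<le> 0")
    case True
    then have "v * s \<le> 0" using that by (simp add: mult_nonneg_nonpos)
    moreover have "0 < m * (1 - u)" using that by simp
    ultimately show ?thesis by simp
  next
    case False
    then show ?thesis using that by (intro mult_strict_mono) auto
  qed
  \<comment> \<open>The copy of \<open>[0,r]\<close> at \<open>x\<close> cannot descend below the
    origin: its end has abscissa \<open>x1 + r1 < z1 + r1 = p1 \<le> 1\<close>, so it would cross a
    basis segment at the origin. The other coordinate is symmetric.\<close>
  have 2: "- r2 \<le> x2"
  proof (rule ccontr)
    assume n: "\<not> ?thesis"
    then have "- r2 \<le> x1 * - r2 + x2 * r1" 
      using no_overlap_below[OF O X(1) _ _ _ _ r(2)] assms by auto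
    also have "x2 * r1 < - r2 * (1 - x1)"
      using assms r n by (intro aux) auto
    finally show False by (simp add: algebra_simps)
  qed
  have 1: "- r1 \<le> x1"
  proof (rule ccontr)
    assume n: "\<not> ?thesis"
    then have "- r1 \<le> x2 * - r1 + x1 * r2" 
      using swap.no_overlap_below[OF O' X(2) _ _ _ _ rs] assms by auto
    also have "x1 * r2 < - r1 * (1 - x2)"
      using assms r n by (intro aux) auto
    finally show False by (simp add: algebra_simps)
  qed
  \<comment> \<open>Now \<open>p = z + r\<close> is at least \<open>z - x\<close>, hence exceeds
    \<open>z - y\<close>, in both coordinates: the copy of \<open>[0,p]\<close> at \<open>y\<close>
    reaches beyond \<open>z\<close>.\<close>
  show False
    using not_both_below[of y1 y2 z1 z2 p1 p2] assms r 1 2 by auto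
qed

section \<open>Counting the centres cell by cell\<close>

lemma coord_bounds:
  assumes "(x1, x2) \<in> X"
  shows "\<bar>x1\<bar> \<le> 2" "\<bar>x2\<bar> \<le> 2"
  using assms by (auto elim!: touchingE)

text \<open>Members of a cell are pairwise comparable, so three of them form a chain in one of six
  orders.\<close>

lemma card_cell_le_2:
  assumes "C \<subseteq> X"
    and close: "\<And>x1 x2 y1 y2. \<lbrakk>(x1, x2) \<in> C; (y1, y2) \<in> C\<rbrakk> \<Longrightarrow> \<bar>y1 - x1\<bar> < 1 \<and> \<bar>y2 - x2\<bar> < 1"
    and chain: "\<And>x1 x2 y1 y2 z1 z2. \<lbrakk>(x1, x2) \<in> C; (y1, y2) \<in> C; (z1, z2) \<in> C;
      x1 < y1; x2 < y2; y1 < z1; y2 < z2; z1 - x1 < 1; z2 - x2 < 1\<rbrakk> \<Longrightarrow> False"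
  shows "card C \<le> 2"
proof (rule ccontr)
  assume "\<not> card C \<le> 2"
  then have "3 \<le> card C" by simp
  then obtain T where T: "T \<subseteq> C" "card T = 3" using obtain_subset_with_card_n by metis
  then obtain x y z where "x \<in> C" "y \<in> C" "z \<in> C" "x \<noteq> y" "y \<noteq> z" "x \<noteq> z"
    by (auto simp: card_3_iff)
  then obtain x1 x2 y1 y2 z1 z2 where
    C: "(x1, x2) \<in> C" "(y1, y2) \<in> C" "(z1, z2) \<in> C"
    and distinct: "(x1, x2) \<noteq> (y1, y2)" "(y1, y2) \<noteq> (z1, z2)" "(x1, x2) \<noteq> (z1, z2)"
    by (metis prod.collapse)
  note d = close[OF C(1,2)] close[OF C(2,3)] close[OF C(1,3)]
  have "(x1 < y1 \<and> x2 < y2) \<or> (y1 < x1 \<and> y2 < x2)" "(y1 < z1 \<and> y2 < z2) \<or> (z1 < y1 \<and> z2 < y2)"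
    "(x1 < z1 \<and> x2 < z2) \<or> (z1 < x1 \<and> z2 < x2)"
    using C distinct d assms(1) by (intro close_points_ordered; blast)+
  then show False
    using chain[OF C(1,2,3)] chain[OF C(1,3,2)] chain[OF C(2,1,3)] chain[OF C(2,3,1)]
      chain[OF C(3,1,2)] chain[OF C(3,2,1)] d by argo
qed

lemma card_cell_le_1:
  assumes "C \<subseteq> X"
    and close: "\<And>x1 x2 y1 y2. \<lbrakk>(x1, x2) \<in> C; (y1, y2) \<in> C\<rbrakk> \<Longrightarrow> \<bar>y1 - x1\<bar> < 1 \<and> \<bar>y2 - x2\<bar> < 1"
    and chain: "\<And>x1 x2 y1 y2. \<lbrakk>(x1, x2) \<in> C; (y1, y2) \<in> C;
      x1 < y1; x2 < y2; y1 - x1 < 1; y2 - x2 < 1\<rbrakk> \<Longrightarrow> False"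
  shows "card C \<le> 1"
proof -
  have "x = y" if "x \<in> C" "y \<in> C" for x y
  proof (rule ccontr)
    assume "x \<noteq> y"
    obtain x1 x2 y1 y2 where xy: "x = (x1, x2)" "y = (y1, y2)" by (metis prod.collapse)
    have "(x1 < y1 \<and> x2 < y2) \<or> (y1 < x1 \<and> y2 < x2)"
      using that \<open>x \<noteq> y\<close> close[of x1 x2 y1 y2] assms(1) by (intro close_points_ordered) (auto simp: xy)
    then show False
      using chain[of x1 x2 y1 y2] chain[of y1 y2 x1 x2] close[of x1 x2 y1 y2] that
      by (auto simp: xy)
  qed
  \<comment> \<open>For infinite \<open>C\<close> the default \<open>card C = 0\<close>
    applies.\<close>
  then show ?thesis
    by (cases "finite C") (auto simp: card_le_Suc0_iff_eq)
qed

text \<open>Points on one vertical line are never strictly comparable, so each half-open unit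
  interval holds at most one centre.\<close>

lemma card_upper_axis_le: "card {(a, b) \<in> X. a = 0 \<and> 0 < b} \<le> 2"
proof -
  have "{(a, b) \<in> X. a = 0 \<and> 0 < b}
      = {(a, b) \<in> X. a = 0 \<and> 0 < b \<and> b \<le> 1} \<union> {(a, b) \<in> X. a = 0 \<and> 1 < b}" by auto
  moreover have "card {(a, b) \<in> X. a = 0 \<and> 0 < b \<and> b \<le> 1} \<le> 1"
    by (rule card_cell_le_1) auto
  moreover have "card {(a, b) \<in> X. a = 0 \<and> 1 < b} \<le> 1"
    by (rule card_cell_le_1) (auto dest!: coord_bounds(2))
  ultimately show ?thesis
    using card_Un_le[of "{(a, b) \<in> X. a = 0 \<and> 0 < b \<and> b \<le> 1}" "{(a, b) \<in> X. a = 0 \<and> 1 < b}"]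
    by simp
qed

lemma card_upper_half_le: "card {(a, b) \<in> X. 0 < b} \<le> 15"
proof -
  define cell where "cell I J = X \<inter> I \<times> J" for I J :: "real set"
  have sub: "cell I J \<subseteq> X" for I J by (auto simp: cell_def)
  have le_2: "card (cell I J) \<le> 2"
    if "\<And>x y. x \<in> I \<Longrightarrow> y \<in> I \<Longrightarrow> \<bar>y - x\<bar> < 1" "\<And>x y. x \<in> J \<Longrightarrow> y \<in> J \<Longrightarrow> \<bar>y - x\<bar> < 1"
      and chain: "\<And>x1 x2 y1 y2 z1 z2. \<lbrakk>(x1, x2) \<in> X; (y1, y2) \<in> X; (z1, z2) \<in> X;
        x1 < y1; x2 < y2; y1 < z1; y2 < z2; z1 - x1 < 1; z2 - x2 < 1;
        x1 \<in> I; y1 \<in> I; z1 \<in> I; x2 \<in> J; y2 \<in> J; z2 \<in> J\<rbrakk> \<Longrightarrow> False" for I J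
  proof (rule card_cell_le_2[OF sub])
    fix x1 x2 y1 y2 z1 z2
    assume "(x1, x2) \<in> cell I J" "(y1, y2) \<in> cell I J" "(z1, z2) \<in> cell I J"
      "x1 < y1" "x2 < y2" "y1 < z1" "y2 < z2" "z1 - x1 < 1" "z2 - x2 < 1"
    then show False using chain[of x1 x2 y1 y2 z1 z2] by (simp add: cell_def)
  qed (use that in \<open>simp add: cell_def\<close>)
  have le_1: "card (cell I J) \<le> 1"
    if "\<And>x y. x \<in> I \<Longrightarrow> y \<in> I \<Longrightarrow> \<bar>y - x\<bar> < 1" "\<And>x y. x \<in> J \<Longrightarrow> y \<in> J \<Longrightarrow> \<bar>y - x\<bar> < 1"
      and chain: "\<And>x1 x2 y1 y2. \<lbrakk>(x1, x2) \<in> X; (y1, y2) \<in> X;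
        x1 < y1; x2 < y2; y1 - x1 < 1; y2 - x2 < 1; x1 \<in> I; y1 \<in> I; x2 \<in> J; y2 \<in> J\<rbrakk> \<Longrightarrow> False" for I J
  proof (rule card_cell_le_1[OF sub])
    fix x1 x2 y1 y2
    assume "(x1, x2) \<in> cell I J" "(y1, y2) \<in> cell I J"
      "x1 < y1" "x2 < y2" "y1 - x1 < 1" "y2 - x2 < 1"
    then show False using chain[of x1 x2 y1 y2] by (simp add: cell_def)
  qed (use that in \<open>simp add: cell_def\<close>)
  \<comment> \<open>Half-open cells keep coordinate differences strictly below 1, as comparability
    requires.\<close>
  have U: "{(a, b) \<in> X. 0 < b} = {(a, b) \<in> X. a = 0 \<and> 0 < b} \<union>
    (cell {-2..<-1} {0<..1} \<union> cell {-1..<0} {0<..1} \<union> cell {0<..1} {0<..1} \<union> cell {1<..2} {0<..1} \<union>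
     cell {-2..<-1} {1<..2} \<union> cell {-1..<0} {1<..2} \<union> cell {0<..1} {1<..2} \<union> cell {1<..2} {1<..2})"
    (is "?U = ?A \<union> (?C1 \<union> ?C2 \<union> ?C3 \<union> ?C4 \<union> ?C5 \<union> ?C6 \<union> ?C7 \<union> ?C8)")
  proof (intro set_eqI, clarify)
    fix a b
    have "- 2 \<le> a" "a \<le> 2" "b \<le> 2" if "(a, b) \<in> X" using coord_bounds[OF that] by auto
    then show "(a, b) \<in> ?U \<longleftrightarrow>
        (a, b) \<in> ?A \<union> (?C1 \<union> ?C2 \<union> ?C3 \<union> ?C4 \<union> ?C5 \<union> ?C6 \<union> ?C7 \<union> ?C8)"
      by (cases "(a, b) \<in> X"; simp add: cell_def; argo)
  qed
  have c1: "card ?C1 \<le> 2"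
    by (rule le_2; (erule (8) no_three_in_left_chain)?; auto)
  \<comment> \<open>The middle point of a chain is interior to this cell, hence must be comparable
    with the origin, but its coordinates have opposite signs.\<close>
  have c2: "card ?C2 \<le> 2"
  proof (rule le_2)
    fix x1 x2 y1 y2 z1 z2
    assume "(y1, y2) \<in> X" "x1 < y1" "y2 < z2" "x1 \<in> {-1..<0}" "y1 \<in> {-1..<0}"
      "y2 \<in> {0<..1}" "z2 \<in> {0<..1}"
    then show False using close_points_ordered[of 0 0 y1 y2] by (simp add: zero_prod_def)
  qed auto
  have c3: "card ?C3 \<le> 2"
    by (rule le_2; (erule (6) no_three_in_central_chain)?; auto)
  have c4: "card ?C4 \<le> 1"
    by (rule le_1; (erule (5) no_two_in_right_upper)?; auto)
  have c5: "card ?C5 \<le> 2"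
    by (rule le_2; (erule (8) no_three_in_upper_chain)?; auto)
  have c6: "card ?C6 \<le> 2"
    by (rule le_2; (erule (8) no_three_in_upper_chain)?; auto)
  have c7: "card ?C7 \<le> 1"
    by (rule le_1; (erule (5) no_two_in_upper_right)?; auto)
  have c8: "card ?C8 \<le> 1"
    by (rule le_1; (erule (5) no_two_in_upper_right)?; auto)
  have "card ?U \<le> 2 + (2 + 2 + 2 + 1 + 2 + 2 + 1 + 1)"
    unfolding U by (intro card_Un_le_add card_upper_axis_le c1 c2 c3 c4 c5 c6 c7 c8)
  then show ?thesis by simp
qed

text \<open>Negation carries the lower half plane to the upper one, and exchange of coordinates the
  horizontal axis to the vertical one.\<close>

lemma card_le: "card X \<le> 34"
proof -
  interpret uminus: star_packing S "uminus ` X" by (rule star_packing_uminus)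
  interpret swap: star_packing "prod.swap ` S" "prod.swap ` X" by (rule star_packing_swap)
  interpret uminus_swap: star_packing "prod.swap ` S" "uminus ` prod.swap ` X"
    by (rule swap.star_packing_uminus)
  have img: "card (f ` A) = card A" if "inj f" for A :: "(real \<times> real) set" and f :: "real \<times> real \<Rightarrow> real \<times> real"
    using that by (simp add: card_image inj_on_subset)
  have inj: "inj (uminus :: real \<times> real \<Rightarrow> real \<times> real)" "inj (prod.swap :: real \<times> real \<Rightarrow> real \<times> real)"
    by (auto simp: inj_def)
  have "{(a, b) \<in> uminus ` X. 0 < b} = uminus ` {(a, b) \<in> X. b < 0}" by force
  then have low: "card {(a, b) \<in> X. b < 0} \<le> 15"
    using uminus.card_upper_half_le by (simp add: img inj)
  have "{(a, b) \<in> prod.swap ` X. a = 0 \<and> 0 < b} = prod.swap ` {(a, b) \<in> X. b = 0 \<and> 0 < a}" by force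
  then have right: "card {(a, b) \<in> X. b = 0 \<and> 0 < a} \<le> 2"
    using swap.card_upper_axis_le by (simp add: img inj)
  have "{(a, b) \<in> uminus ` prod.swap ` X. a = 0 \<and> 0 < b}
      = uminus ` prod.swap ` {(a, b) \<in> X. b = 0 \<and> a < 0}" by force
  then have left: "card {(a, b) \<in> X. b = 0 \<and> a < 0} \<le> 2"
    using uminus_swap.card_upper_axis_le by (simp add: img inj)
  have "x \<in> X \<longleftrightarrow> x \<in> {(a, b) \<in> X. 0 < b} \<union> ({(a, b) \<in> X. b < 0} \<union>
      ({(a, b) \<in> X. b = 0 \<and> 0 < a} \<union> {(a, b) \<in> X. b = 0 \<and> a < 0}))" for x
    using zero
    by (cases x; cases "fst x" "0 :: real" rule: linorder_cases; cases "snd x" "0 :: real" rule: linorder_cases)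
      (auto simp: zero_prod_def)
  then have "X = {(a, b) \<in> X. 0 < b} \<union> ({(a, b) \<in> X. b < 0} \<union>
      ({(a, b) \<in> X. b = 0 \<and> 0 < a} \<union> {(a, b) \<in> X. b = 0 \<and> a < 0}))" (is "_ = ?R") by blast
  then have "card X = card ?R" by (rule arg_cong)
  also have "\<dots> \<le> 15 + (15 + (2 + 2))"
    by (intro card_Un_le_add card_upper_half_le low right left)
  finally show ?thesis by simp
qed

end

subsection \<open>Overlaps of translates of a starlike body\<close>

lemma topological_disk_compact: "topological_disk S \<Longrightarrow> compact S"
  unfolding topological_disk_def using homeomorphic_compactness compact_cball by blast

text \<open>By invariance of domain the open ball is mapped into the interior, and its closure is
  the closed ball.\<close>

lemma topological_disk_closure_interior:
  assumes "topological_disk S"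
  shows "S \<subseteq> closure (interior S)"
proof -
  obtain g f where "homeomorphism S (cball 0 1 :: (real^2) set) g f"
    using assms unfolding topological_disk_def homeomorphic_def by blast
  then have f: "continuous_on (cball 0 1) f" "f ` cball 0 1 = S" "inj_on f (cball 0 1)"
    by (auto simp: homeomorphism_def intro: inj_on_inverseI)
  have "open (f ` ball 0 1)"
    using f by (intro invariance_of_domain)
      (auto intro: continuous_on_subset inj_on_subset[OF _ ball_subset_cball])
  then have int: "f ` ball 0 1 \<subseteq> interior S"
    using f(2) ball_subset_cball by (intro interior_maximal) auto
  have "f ` closure (ball 0 1) \<subseteq> closure (f ` ball 0 1)"
    using f(1) by (intro continuous_image_closure_subset[of "cball 0 1"]) auto
  then have "S \<subseteq> closure (f ` ball 0 1)" by (simp add: f(2))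
  also have "\<dots> \<subseteq> closure (interior S)" using int by (rule closure_mono)
  finally show ?thesis .
qed

section \<open>Planar determinants\<close>

definition det2 :: "real^2 \<Rightarrow> real^2 \<Rightarrow> real"
  where "det2 a b = a $ 1 * b $ 2 - a $ 2 * b $ 1"

lemma tendsto_det2:
  "\<lbrakk>(f \<longlongrightarrow> a) F; (g \<longlongrightarrow> b) F\<rbrakk> \<Longrightarrow> ((\<lambda>x. det2 (f x) (g x)) \<longlongrightarrow> det2 a b) F"
  unfolding det2_def by (intro tendsto_intros)

lemma continuous_on_det2 [continuous_intros]:
  "\<lbrakk>continuous_on A f; continuous_on A g\<rbrakk> \<Longrightarrow> continuous_on A (\<lambda>x. det2 (f x) (g x))"
  unfolding det2_def by (intro continuous_intros)

text \<open>Cramer's rule, with signs matching the form \<open>s a - t b\<close> of a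
  crossing.\<close>

lemma det2_cramer:
  assumes "det2 a b \<noteq> 0"
  shows "w = (det2 w b / det2 a b) *\<^sub>R a - (det2 w a / det2 a b) *\<^sub>R b"
proof -
  have "det2 a b *\<^sub>R w = det2 w b *\<^sub>R a - det2 w a *\<^sub>R b"
    by (simp add: det2_def vec_eq_iff forall_2 algebra_simps)
  then have "inverse (det2 a b) *\<^sub>R det2 a b *\<^sub>R w = inverse (det2 a b) *\<^sub>R (det2 w b *\<^sub>R a - det2 w a *\<^sub>R b)"
    by (rule arg_cong)
  then show ?thesis using assms by (simp add: scaleR_diff_right divide_inverse mult.commute)
qed

lemma det2_simps [simp]:
  "det2 (s *\<^sub>R a) b = s * det2 a b" "det2 a (s *\<^sub>R b) = s * det2 a b" "det2 a a = 0"
  "det2 (a + c) b = det2 a b + det2 c b" "det2 a (b + c) = det2 a b + det2 a c"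
  "det2 (a - c) b = det2 a b - det2 c b" "det2 a (b - c) = det2 a b - det2 a c"
  "det2 0 b = 0" "det2 a 0 = 0"
  by (auto simp: det2_def algebra_simps)

lemma det2_commute: "det2 b a = - det2 a b"
  by (simp add: det2_def)

lemma exists_det2_nonzero:
  assumes "open U" "u \<in> U" "a \<noteq> 0" "e > 0"
  shows "\<exists>v\<in>U. dist v u < e \<and> det2 a v \<noteq> 0"
proof (cases "det2 a u = 0")
  case False
  then show ?thesis using assms by (intro bexI[of _ u]) auto
next
  case True
  \<comment> \<open>\<open>w\<close> is \<open>a\<close> turned by a right angle, so
    \<open>det2 a w\<close> is the squared norm of \<open>a\<close>.\<close>
  define w :: "real^2" where "w = (\<chi> i. if i = 1 then - a $ 2 else a $ 1)"
  have w: "det2 a w > 0"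
    using \<open>a \<noteq> 0\<close> by (simp add: det2_def w_def vec_eq_iff forall_2 sum_squares_gt_zero_iff)
  obtain d where d: "d > 0" "ball u d \<subseteq> U" using assms open_contains_ball by blast
  have w0: "w \<noteq> 0" using w by auto
  define k where "k = min d e / (2 * norm w)"
  have "k > 0" "k * norm w < d" "k * norm w < e" using d assms w0 by (auto simp: k_def)
  then show ?thesis
    using d True w by (intro bexI[of _ "u + k *\<^sub>R w"]) (auto simp: dist_norm subset_eq)
qed

text \<open>The star centre is 0. Segments in \<open>S\<close> may run along its boundary, while
  \<open>nonoverlapping\<close> concerns interiors; \<open>regular\<close> lets their ends be
  approximated from the interior.\<close>

locale star_body =
  fixes S :: "(real^2) set"
  assumes star: "q \<in> S \<Longrightarrow> 0 \<le> t \<Longrightarrow> t \<le> 1 \<Longrightarrow> t *\<^sub>R q \<in> S"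
    and regular: "S \<subseteq> closure (interior S)"
begin

lemma scaleR_interior:
  assumes "q \<in> interior S" "0 < t" "t \<le> 1"
  shows "t *\<^sub>R q \<in> interior S"
proof -
  have "open ((*\<^sub>R) t ` interior S)" using assms by (intro open_scaling) auto
  moreover have "(*\<^sub>R) t ` interior S \<subseteq> S"
  proof (rule image_subsetI)
    fix x assume "x \<in> interior S"
    then have "x \<in> S" using interior_subset by blast
    then show "t *\<^sub>R x \<in> S" using assms by (intro star) auto
  qed
  ultimately have "(*\<^sub>R) t ` interior S \<subseteq> interior S" by (intro interior_maximal)
  then show ?thesis using assms(1) by blast
qed

lemma overlap_cramer:
  assumes "a \<in> interior S" "b \<in> interior S" "det2 a b \<noteq> 0"
    "0 < det2 w b / det2 a b" "det2 w b / det2 a b < 1" "0 < det2 w a / det2 a b" "det2 w a / det2 a b < 1"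
  shows "\<exists>y\<in>interior S. \<exists>z\<in>interior S. w = y - z"
  using det2_cramer[OF assms(3)] assms scaleR_interior by (meson less_imp_le)

text \<open>For fixed \<open>w\<close> the Cramer coefficients vary continuously with the two
  vectors, so they stay in the open interval from 0 to 1 when \<open>a\<close> and \<open>b\<close>
  are replaced by nearby interior points.\<close>

lemma overlap_transversal:
  assumes "a \<in> S" "b \<in> S" "det2 a b \<noteq> 0" "0 < s" "s < 1" "0 < t" "t < 1"
  shows "\<exists>y\<in>interior S. \<exists>z\<in>interior S. s *\<^sub>R a - t *\<^sub>R b = y - z"
proof -
  define w where "w = s *\<^sub>R a - t *\<^sub>R b"
  obtain f where f: "\<And>n. f n \<in> interior S" "f \<longlonglongrightarrow> a"
    using regular assms(1) closure_sequential by (metis subsetD)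
  obtain g where g: "\<And>n. g n \<in> interior S" "g \<longlonglongrightarrow> b"
    using regular assms(2) closure_sequential by (metis subsetD)
  have w: "det2 w b / det2 a b = s" "det2 w a / det2 a b = t"
    using assms(3) by (auto simp: w_def det2_commute[of b a])
  have d: "(\<lambda>n. det2 (f n) (g n)) \<longlonglongrightarrow> det2 a b" using f g by (intro tendsto_det2)
  have 1: "(\<lambda>n. det2 w (g n) / det2 (f n) (g n)) \<longlonglongrightarrow> s"
    unfolding w(1)[symmetric] using assms(3) f g d by (intro tendsto_intros tendsto_det2)
  have 2: "(\<lambda>n. det2 w (f n) / det2 (f n) (g n)) \<longlonglongrightarrow> t"
    unfolding w(2)[symmetric] using assms(3) f g d by (intro tendsto_intros tendsto_det2)
  have "eventually (\<lambda>n. det2 (f n) (g n) \<noteq> 0 \<and>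
      0 < det2 w (g n) / det2 (f n) (g n) \<and> det2 w (g n) / det2 (f n) (g n) < 1 \<and>
      0 < det2 w (f n) / det2 (f n) (g n) \<and> det2 w (f n) / det2 (f n) (g n) < 1) sequentially"
    using assms
    by (intro eventually_conj tendsto_imp_eventually_ne[OF d] order_tendstoD[OF 1] order_tendstoD[OF 2])
  then obtain n where "det2 (f n) (g n) \<noteq> 0 \<and>
      0 < det2 w (g n) / det2 (f n) (g n) \<and> det2 w (g n) / det2 (f n) (g n) < 1 \<and>
      0 < det2 w (f n) / det2 (f n) (g n) \<and> det2 w (f n) / det2 (f n) (g n) < 1"
    using eventually_happens by fastforce
  then show ?thesis
    unfolding w_def[symmetric] using overlap_cramer[of "f n" "g n" w] f g by blast
qed

text \<open>Infinitely many interior points approximating \<open>a\<close> lie on one side of the line through \<open>a\<close>;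
  two of them at very different distances from the line give the overlap.\<close>

lemma overlap_collinear:
  assumes "a \<in> S" "a \<noteq> 0" "0 < s" "s < 1"
  shows "\<exists>y\<in>interior S. \<exists>z\<in>interior S. s *\<^sub>R a = y - z"
proof -
  define U where "U \<sigma> = {x \<in> interior S. 0 < \<sigma> * det2 a x}" for \<sigma> :: real
  have "a \<in> closure (U 1 \<union> U (-1))"
    unfolding closure_approachable
  proof (intro allI impI)
    fix e :: real assume "e > 0"
    have "a \<in> closure (interior S)" using assms regular by blast
    then obtain x where x: "x \<in> interior S" "dist x a < e / 2"
      using \<open>e > 0\<close> closure_approachable by (metis half_gt_zero)
    obtain y where "y \<in> interior S" "dist y x < e / 2" "det2 a y \<noteq> 0"
      using exists_det2_nonzero[of "interior S" x a "e / 2"] x assms \<open>e > 0\<close> by auto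
    moreover have "dist y a \<le> dist y x + dist x a" by (rule dist_triangle)
    ultimately show "\<exists>y\<in>U 1 \<union> U (-1). dist y a < e"
      using x by (intro bexI[of _ y]) (auto simp: U_def)
  qed
  then obtain \<sigma> where "a \<in> closure (U \<sigma>)" by auto
  then obtain f where f: "\<And>n. f n \<in> U \<sigma>" "f \<longlonglongrightarrow> a" using closure_sequential by metis
  \<comment> \<open>\<open>b\<close> is the far point, kept fixed; \<open>f n\<close> is the near
    one.\<close>
  define b w where "b = f 0" and "w = s *\<^sub>R a"
  have b: "b \<in> interior S" "0 < \<sigma> * det2 a b" using f(1)[of 0] by (auto simp: U_def b_def)
  have d: "(\<lambda>n. det2 (f n) b) \<longlonglongrightarrow> det2 a b" using f by (intro tendsto_det2) auto
  have ne: "det2 a b \<noteq> 0" using b by auto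
  have 1: "(\<lambda>n. det2 w b / det2 (f n) b) \<longlonglongrightarrow> det2 w b / det2 a b"
    using ne d by (intro tendsto_intros)
  have 2: "(\<lambda>n. det2 w (f n) / det2 (f n) b) \<longlonglongrightarrow> det2 w a / det2 a b"
    using f ne d by (intro tendsto_intros tendsto_det2)
  have 3: "(\<lambda>n. \<sigma> * det2 (f n) b) \<longlonglongrightarrow> \<sigma> * det2 a b" using d by (intro tendsto_intros)
  have w: "det2 w b / det2 a b = s" "det2 w a / det2 a b = 0" using ne by (auto simp: w_def)
  have "eventually (\<lambda>n. 0 < \<sigma> * det2 (f n) b \<and> 0 < det2 w b / det2 (f n) b \<and>
      det2 w b / det2 (f n) b < 1 \<and> det2 w (f n) / det2 (f n) b < 1) sequentially"
    using assms b w
    by (intro eventually_conj order_tendstoD[OF 1] order_tendstoD[OF 2] order_tendstoD[OF 3]) auto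
  then obtain n where n: "0 < \<sigma> * det2 (f n) b" "0 < det2 w b / det2 (f n) b"
      "det2 w b / det2 (f n) b < 1" "det2 w (f n) / det2 (f n) b < 1"
    using eventually_happens by fastforce
  have fn: "f n \<in> interior S" "0 < \<sigma> * det2 a (f n)" using f(1)[of n] by (auto simp: U_def)
  \<comment> \<open>This coefficient tends to 0 but is positive: \<open>det2 a (f n)\<close> and
    \<open>det2 (f n) b\<close> both have the sign of \<open>\<sigma>\<close>.\<close>
  then have "0 < det2 w (f n) / det2 (f n) b"
    using n(1) assms by (auto simp: w_def zero_less_divide_iff zero_less_mult_iff mult_less_0_iff)
  moreover have "det2 (f n) b \<noteq> 0" using n(1) by auto
  ultimately show ?thesis
    unfolding w_def[symmetric] using overlap_cramer[of "f n" b w] n fn b by blast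
qed

lemma overlap:
  assumes "a \<in> S" "b \<in> S" "det2 a b \<noteq> 0" "0 \<le> s" "s < 1" "0 \<le> t" "t < 1"
  shows "\<exists>y\<in>interior S. \<exists>z\<in>interior S. s *\<^sub>R a - t *\<^sub>R b = y - z"
proof -
  have ne: "a \<noteq> 0" "b \<noteq> 0" using assms(3) by auto
  consider "s > 0" "t > 0" | "s > 0" "t = 0" | "s = 0" "t > 0" | "s = 0" "t = 0" using assms by linarith
  then show ?thesis
  proof cases
    case 1
    then show ?thesis using overlap_transversal assms by blast
  next
    case 2
    then show ?thesis using overlap_collinear[of a s] ne assms by auto
  next
    case 3
    then obtain y z where "y \<in> interior S" "z \<in> interior S" "t *\<^sub>R b = y - z"
      using overlap_collinear[of b t] ne assms by auto
    then show ?thesis using 3 by (intro bexI[of _ z] bexI[of _ y]) auto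
  next
    case 4
    obtain y where "y \<in> interior S" using assms(1) regular by (metis closure_empty empty_iff ex_in_conv subsetD)
    then show ?thesis using 4 by auto
  qed
qed

text \<open>Coordinates in a basis of maximal determinant lead to \<open>star_packing\<close>;
  \<open>disjoint\<close> is nonoverlapping expressed by translation vectors.\<close>

lemma card_touching_translations_le:
  assumes "compact S" "S \<noteq> {}"
    and "0 \<notin> V"
    and touching: "\<And>v. v \<in> V \<Longrightarrow> \<exists>p\<in>S. \<exists>r\<in>S. v = p - r"
    and disjoint: "\<And>v w y z. \<lbrakk>v \<in> insert 0 V; w \<in> insert 0 V; y \<in> interior S; z \<in> interior S;
      v - w = y - z\<rbrakk> \<Longrightarrow> v = w"
  shows "card V \<le> 34"
proof -
  have "compact (S \<times> S)" "S \<times> S \<noteq> {}" using assms by (simp_all add: compact_Times)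
  moreover have "continuous_on (S \<times> S) (\<lambda>x. \<bar>det2 (fst x) (snd x)\<bar>)" by (intro continuous_intros)
  ultimately have "\<exists>x\<in>S \<times> S. \<forall>y\<in>S \<times> S. \<bar>det2 (fst y) (snd y)\<bar> \<le> \<bar>det2 (fst x) (snd x)\<bar>"
    by (rule continuous_attains_sup)
  then obtain x where "x \<in> S \<times> S" "\<forall>y\<in>S \<times> S. \<bar>det2 (fst y) (snd y)\<bar> \<le> \<bar>det2 (fst x) (snd x)\<bar>" by blast
  moreover define f g where "f = fst x" and "g = snd x"
  ultimately have fg: "f \<in> S" "g \<in> S"
    and max: "\<And>a b. a \<in> S \<Longrightarrow> b \<in> S \<Longrightarrow> \<bar>det2 a b\<bar> \<le> \<bar>det2 f g\<bar>"
    by (auto simp: mem_Times_iff)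
  have D: "det2 f g \<noteq> 0"
  proof -
    have "interior S \<noteq> {}" using assms(2) regular by auto
    then obtain u where u: "u \<in> interior S" by blast
    obtain a where a: "a \<in> interior S" "det2 (axis 1 1) a \<noteq> 0"
      using exists_det2_nonzero[of "interior S" u "axis 1 1" 1] u by (auto simp: axis_eq_0_iff)
    then have "a \<noteq> 0" by auto
    then obtain b where b: "b \<in> interior S" "det2 a b \<noteq> 0"
      using exists_det2_nonzero[of "interior S" u a 1] u by auto
    have "a \<in> S" "b \<in> S" using a b interior_subset by blast+
    then show ?thesis using max[of a b] b by auto
  qed
  define \<phi> where "\<phi> x = (det2 x g / det2 f g, - det2 x f / det2 f g)" for x
  have inv: "x = fst (\<phi> x) *\<^sub>R f + snd (\<phi> x) *\<^sub>R g" for x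
    using det2_cramer[OF D, of x] by (simp add: \<phi>_def)
  have inj: "inj \<phi>" by (metis injI inv)
  have lin: "\<phi> (x - y) = \<phi> x - \<phi> y" "\<phi> (k *\<^sub>R x) = k *\<^sub>R \<phi> x" for x y k
    by (simp_all add: \<phi>_def diff_divide_distrib)
  have det: "det2 a b = (fst (\<phi> a) * snd (\<phi> b) - snd (\<phi> a) * fst (\<phi> b)) * det2 f g" for a b
    by (subst inv[of a], subst inv[of b]) (simp add: det2_commute[of g f] algebra_simps del: inv)
  have \<phi>0: "\<phi> 0 = 0" using lin(2)[of 0 0] by simp
  interpret star_packing "\<phi> ` S" "\<phi> ` V"
  proof
    \<comment> \<open>By Cramer's rule each coordinate is, up to sign, a determinant of two points
      of \<open>S\<close> over the maximal one.\<close>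
    show "\<bar>u\<bar> \<le> 1 \<and> \<bar>v\<bar> \<le> 1" if "(u, v) \<in> \<phi> ` S" for u v
      using that max[OF _ fg(2)] max[OF _ fg(1)] D by (auto simp: \<phi>_def)
    show "(1, 0) \<in> \<phi> ` S"
      using fg D by (intro image_eqI[of _ _ f]) (simp_all add: \<phi>_def)
    show "(0, 1) \<in> \<phi> ` S"
      using fg D by (intro image_eqI[of _ _ g]) (simp_all add: \<phi>_def det2_commute[of g f])
    show "0 \<notin> \<phi> ` V" using \<phi>0 inj \<open>0 \<notin> V\<close> by (metis imageE injD)
    show "\<exists>p\<in>\<phi> ` S. \<exists>r\<in>\<phi> ` S. x = p - r" if x: "x \<in> \<phi> ` V" for x
    proof -
      obtain v where v: "v \<in> V" "x = \<phi> v" using x by blast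
      then obtain p r where "p \<in> S" "r \<in> S" "v = p - r" using touching by blast
      then show ?thesis using v lin(1) by blast
    qed
  next
    fix x y a b and s t :: real
    assume xy: "x \<in> insert 0 (\<phi> ` V)" "y \<in> insert 0 (\<phi> ` V)" and ab: "a \<in> \<phi> ` S" "b \<in> \<phi> ` S"
      and ne: "fst a * snd b \<noteq> snd a * fst b" and st: "0 \<le> s" "s < 1" "0 \<le> t" "t < 1"
      and eq: "x - y = s *\<^sub>R a - t *\<^sub>R b"
    have "insert 0 (\<phi> ` V) = \<phi> ` insert 0 V" using \<phi>0 by simp
    with xy have "x \<in> \<phi> ` insert 0 V" "y \<in> \<phi> ` insert 0 V" by (simp_all only:)
    then obtain v w where vw: "v \<in> insert 0 V" "w \<in> insert 0 V" "x = \<phi> v" "y = \<phi> w" by (elim imageE)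
    obtain c d where cd: "c \<in> S" "d \<in> S" "a = \<phi> c" "b = \<phi> d" using ab by blast
    have "det2 c d \<noteq> 0" using det[of c d] ne D by (auto simp: cd)
    then obtain p q where "p \<in> interior S" "q \<in> interior S" "s *\<^sub>R c - t *\<^sub>R d = p - q"
      using overlap[of c d s t] cd st by blast
    moreover have "\<phi> (v - w) = \<phi> (s *\<^sub>R c - t *\<^sub>R d)" using eq by (simp add: vw cd lin)
    then have "v - w = s *\<^sub>R c - t *\<^sub>R d" using inj by (rule injD[rotated])
    ultimately have "v = w" using disjoint vw by metis
    then show "x = y" using vw by simp
  qed
  show ?thesis using card_le by (simp add: card_image[OF inj_on_subset[OF inj subset_UNIV]])
qed

end

section \<open>From Hadwiger families to translation vectors\<close>

lemma translate_eq_imp_eq: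
  fixes S :: "'a::euclidean_space set"
  assumes "compact S" "S \<noteq> {}" and eq: "(+) v ` S = (+) w ` S"
  shows "v = w"
proof -
  \<comment> \<open>A point of \<open>S\<close> extremal in direction \<open>v - w\<close> cannot be
    moved further by \<open>v - w\<close> within \<open>S\<close>.\<close>
  have "continuous_on S (\<lambda>x. x \<bullet> (v - w))" by (intro continuous_intros)
  then obtain x where x: "x \<in> S" "\<And>y. y \<in> S \<Longrightarrow> y \<bullet> (v - w) \<le> x \<bullet> (v - w)"
    using continuous_attains_sup[OF assms(1,2)] by blast
  have "v + x \<in> (+) w ` S" using x(1) eq by blast
  then obtain y where "y \<in> S" "v + x = w + y" by auto
  moreover from this have "y = x + (v - w)" by (simp add: algebra_simps)
  ultimately have "(v - w) \<bullet> (v - w) \<le> 0" using x(2)[of y] by (simp add: inner_add_left)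
  then show ?thesis by (metis inner_gt_zero_iff not_le right_minus_eq)
qed

lemma card_hadwiger_family_le:
  assumes "topological_disk S" "starlike S" "hadwiger_family S F"
  shows "card F \<le> 34"
proof -
  obtain c where c: "c \<in> S" "\<And>x. x \<in> S \<Longrightarrow> closed_segment c x \<subseteq> S"
    using assms(2) by (auto simp: starlike_def)
  define B where "B = (\<lambda>x. x - c) ` S"
  have intB: "interior B = (\<lambda>x. x - c) ` interior S" by (simp add: B_def interior_translation_subtract)
  interpret star_body B
  proof
    fix q and t :: real assume "q \<in> B" "0 \<le> t" "t \<le> 1"
    then obtain x where x: "x \<in> S" "q = x - c" by (auto simp: B_def)
    have "c + t *\<^sub>R (x - c) \<in> closed_segment c x"
      unfolding in_segment using \<open>0 \<le> t\<close> \<open>t \<le> 1\<close> by (intro exI[of _ t]) (simp add: algebra_simps)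
    then have "c + t *\<^sub>R (x - c) \<in> S" using c(2)[OF x(1)] by blast
    then show "t *\<^sub>R q \<in> B" by (auto simp: B_def x intro: image_eqI[of _ _ "c + t *\<^sub>R (x - c)"])
  next
    show "B \<subseteq> closure (interior B)"
      using topological_disk_closure_interior[OF assms(1)]
      by (simp add: intB closure_translation_subtract) (auto simp: B_def)
  qed
  have F: "F \<subseteq> translates S" "pairwise nonoverlapping F" "\<And>K. K \<in> F \<Longrightarrow> touch S K"
    using assms(3) by (auto simp: hadwiger_family_def)
  \<comment> \<open>Differences of points agree for \<open>S\<close> and \<open>B\<close>, so the
    same vectors serve for both.\<close>
  define V where "V = {v. (+) v ` S \<in> F}"
  have FV: "F = (\<lambda>v. (+) v ` S) ` V" using F(1) by (auto simp: V_def translates_def)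
  have ne: "interior S \<noteq> {}" using topological_disk_closure_interior[OF assms(1)] c(1) by auto
  have translate_inj: "v = w" if "(+) v ` S = (+) w ` S" for v w
    using that topological_disk_compact[OF assms(1)] c(1) by (blast intro: translate_eq_imp_eq)
  have int: "interior ((+) v ` S) = (+) v ` interior S" for v by (rule interior_translation)
  \<comment> \<open>\<open>S\<close> overlaps itself because its interior is nonempty.\<close>
  have "0 \<notin> V"
  proof
    assume "0 \<in> V"
    then have "touch S S" using F(3)[of S] by (simp add: V_def)
    then show False using ne by (simp add: touch_def nonoverlapping_def)
  qed
  have disjoint: "v = w" if vw: "v \<in> insert 0 V" "w \<in> insert 0 V" "y \<in> interior S" "z \<in> interior S" "v + y = w + z"
    for v w y z
  proof (rule ccontr)
    assume "v \<noteq> w"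
    then have ne': "(+) v ` S \<noteq> (+) w ` S" using translate_inj by blast
    have touch: "nonoverlapping S ((+) u ` S)" if "u \<in> V" for u
      using F(3)[of "(+) u ` S"] that by (simp add: V_def touch_def)
    have "nonoverlapping ((+) v ` S) ((+) w ` S)"
    proof -
      consider "v = 0" "w \<in> V" | "w = 0" "v \<in> V" | "v \<in> V" "w \<in> V" using vw(1,2) \<open>v \<noteq> w\<close> by auto
      then show ?thesis
      proof cases
        case 1
        then show ?thesis using touch[of w] by simp
      next
        case 2
        then show ?thesis using touch[of v] by (simp add: nonoverlapping_def Int_commute)
      next
        case 3
        then show ?thesis using F(2) ne' by (simp add: V_def pairwise_def)
      qed
    qed
    then have "(+) v ` interior S \<inter> (+) w ` interior S = {}" by (simp only: nonoverlapping_def int)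
    then show False using vw(3-5) by (metis disjoint_iff imageI)
  qed
  have "card V \<le> 34"
  proof (rule card_touching_translations_le)
    have B: "B = (+) (- c) ` S" by (auto simp: B_def)
    show "compact B" unfolding B by (intro compact_translation topological_disk_compact assms)
    show "B \<noteq> {}" using c(1) by (auto simp: B_def)
    show "0 \<notin> V" by fact
    show "\<exists>p\<in>B. \<exists>r\<in>B. v = p - r" if v: "v \<in> V" for v
    proof -
      have "S \<inter> (+) v ` S \<noteq> {}" using F(3)[of "(+) v ` S"] v by (simp add: V_def touch_def)
      then obtain r where "r \<in> S" "v + r \<in> S" by auto
      then show ?thesis
        by (intro bexI[of _ "v + r - c"] bexI[of _ "r - c"]) (auto simp: B_def)
    qed
  next
    fix v w y z
    assume vw: "v \<in> insert 0 V" "w \<in> insert 0 V" and "y \<in> interior B" "z \<in> interior B" and eq: "v - w = y - z"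
    then obtain y' z' where "y' \<in> interior S" "z' \<in> interior S" "y = y' - c" "z = z' - c"
      by (auto simp: intB)
    moreover from this eq have "v - w = y' - z'" by simp
    then have "v + z' = w + y'" by (simp add: algebra_simps)
    ultimately show "v = w" using disjoint vw by blast
  qed
  moreover have inj: "inj_on (\<lambda>v. (+) v ` S) V" using translate_inj by (intro inj_onI)
  ultimately show ?thesis using FV card_image[OF inj] by simp
qed

theorem theorem1:
  fixes S :: "(real^2) set"
  assumes "topological_disk S" and "starlike S"
  shows "hadwiger_number S \<le> 35"
  unfolding hadwiger_number_def
proof (rule SUP_least)
  fix F assume "F \<in> {F. finite F \<and> hadwiger_family S F}"
  then have "card F \<le> 35" using card_hadwiger_family_le[OF assms, of F] by simp
  then show "enat (card F) \<le> 35" by (simp add: numeral_eq_enat)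
qed

end
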